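(* Let $a>b>0$, $c=\sqrt{a^2-b^2}$, and let $\mathcal{E}$ be the ellipse $(x/a)^2+(y/b)^2=1$. For either choice of sign $\pm$, the circle with center and radius $$C_4=\left[\pm\frac{a^2c}{2a^2-c^2},0\right],\qquad r_4=\frac{a(a^2-c^2)}{2a^2-c^2}$$ is a caustic admitting a Poncelet family of triangles inscribed in $\mathcal{E}$, and over this family the orthocenter $X_4$ is stationary at the focus $[\pm c,0]$ of $\mathcal{E}$ (same choice of sign).
   Context: Points of the plane are written $[x,y]$. A circle is a caustic admitting a Poncelet family of triangles inscribed in $\mathcal{E}$ if every point of $\mathcal{E}$ is a vertex of a triangle whose three vertices lie on $\mathcal{E}$ and whose three sidelines are tangent to the circle (here, the circle is the fixed incircle of the triangles); the family is the set of all such triangles. A point is stationary over a family if it is the same for all triangles in the family. *)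

theory Defs
  imports "HOL-Analysis.Analysis"
begin

type_synonym point = "real^2"

definition ellipse :: "real \<Rightarrow> real \<Rightarrow> point set" where
  "ellipse a b = {P. (P $ 1 / a)\<^sup>2 + (P $ 2 / b)\<^sup>2 = 1}"

text \<open>The line through \<open>P\<close> and \<open>Q\<close> (assumed distinct) meets the circle in exactly one point.
  This is tangency provided \<open>r > 0\<close>.\<close>

definition line_tangent_to_circle :: "point \<Rightarrow> point \<Rightarrow> point \<Rightarrow> real \<Rightarrow> bool" where
  "line_tangent_to_circle P Q M r \<longleftrightarrow> (\<exists>T. affine hull {P, Q} \<inter> sphere M r = {T})"

definition sidelines_tangent :: "point \<Rightarrow> real \<Rightarrow> point \<Rightarrow> point \<Rightarrow> point \<Rightarrow> bool" where
  "sidelines_tangent M r A B C \<longleftrightarrow>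
     line_tangent_to_circle A B M r \<and> line_tangent_to_circle B C M r \<and>
     line_tangent_to_circle C A M r"

text \<open>The inner one of the four circles that touch all three sidelines: excircles have their
  centers outside the triangle.\<close>

definition is_incircle :: "point \<Rightarrow> real \<Rightarrow> point \<Rightarrow> point \<Rightarrow> point \<Rightarrow> bool" where
  "is_incircle M r A B C \<longleftrightarrow>
     0 < r \<and> sidelines_tangent M r A B C \<and> M \<in> interior (convex hull {A, B, C})"

text \<open>Triangles are represented by ordered triples, so each triangle occurs once for every
  labelling of its vertices.\<close>

definition poncelet_family :: "point set \<Rightarrow> point \<Rightarrow> real \<Rightarrow> (point \<times> point \<times> point) set" where
  "poncelet_family E M r =
     {(A, B, C). A \<in> E \<and> B \<in> E \<and> C \<in> E \<and> \<not> collinear {A, B, C} \<and> sidelines_tangent M r A B C}"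

definition is_caustic :: "point set \<Rightarrow> point \<Rightarrow> real \<Rightarrow> bool" where
  "is_caustic E M r \<longleftrightarrow>
     0 < r \<and> (\<forall>P\<in>E. \<exists>(A, B, C) \<in> poncelet_family E M r. P \<in> {A, B, C})"

definition altitude :: "point \<Rightarrow> point \<Rightarrow> point \<Rightarrow> point set" where
  "altitude A B C = {P. (P - A) \<bullet> (C - B) = 0}"

definition is_orthocenter :: "point \<Rightarrow> point \<Rightarrow> point \<Rightarrow> point \<Rightarrow> bool" where
  "is_orthocenter H A B C \<longleftrightarrow> altitude A B C \<inter> altitude B C A \<inter> altitude C A B = {H}"

definition stationary_at ::
  "(point \<Rightarrow> point \<Rightarrow> point \<Rightarrow> point \<Rightarrow> bool) \<Rightarrow> (point \<times> point \<times> point) set \<Rightarrow> point \<Rightarrow> bool" where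
  "stationary_at is_center F P \<longleftrightarrow> (\<forall>(A, B, C) \<in> F. is_center P A B C)"

end

theory Submission
  imports Defs
begin

text \<open>
  The two signs are treated alike by putting the origin at the focus \<open>F\<close> in question.  The
  ellipse then consists of the points \<open>X\<close> with \<open>\<bar>X\<bar> = p - e \<bullet> X\<close>, where \<open>p\<close> is the
  semi-latus rectum and the vector \<open>e\<close>, of length less than 1, has the eccentricity as its norm.

  A triangle \<open>A B C\<close> has its orthocenter at the origin iff \<open>A \<bullet> B = B \<bullet> C = C \<bullet> A\<close>.
  If the common value \<open>k\<close> is not zero, the sidelines are the polars \<open>{X. N \<bullet> X = k}\<close> of the
  opposite vertices \<open>N\<close> in a circle about the origin, imaginary when \<open>k < 0\<close>.  The
  polar of \<open>N\<close> has distance \<open>\<bar>N \<bullet> M - k\<bar> / \<bar>N\<bar>\<close> from \<open>M\<close>.  For \<open>M = - r e\<close>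
  and \<open>k = - r p\<close> this is \<open>r \<bar>p - e \<bullet> N\<bar> / \<bar>N\<bar>\<close>, which equals \<open>r\<close> exactly when
  \<open>N\<close> lies on the ellipse.  So for every \<open>r > 0\<close> the tangents of the circle with center \<open>M\<close>
  and radius \<open>r\<close> are the polars of the points of the ellipse; \<open>polar_tangent_iff\<close> and
  \<open>tangent_is_polar\<close> say this for the radius that follows.

  One value of \<open>r\<close>, namely \<open>r = p / (2 - \<bar>e\<bar>\<^sup>2)\<close>, makes the figure close up: if the polar of a
  point \<open>A\<close> of the ellipse cuts the ellipse in \<open>P\<close> and \<open>Q\<close>, then
  \<open>P \<bullet> Q = k\<close> as well (\<open>conjugate_of_polar_chord\<close>).  This is a statement about the product of the
  roots of the quadratic equation for the intersection, because
  \<open>\<bar>A\<bar>\<^sup>2 (P \<bullet> Q) = k\<^sup>2 + t\<^sub>P t\<^sub>Q\<close> when \<open>t\<close> measures position along the polar.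

  Everything follows.  A chord \<open>P Q\<close> that touches the circle is the polar of a point of the ellipse,
  so \<open>P \<bullet> Q = k\<close>; three such chords put the orthocenter at the focus.
  Conversely, each point \<open>A\<close> together with the two intersections of its polar with the ellipse
  is a triangle whose sidelines are the polars of its vertices, hence tangents.  Finally, in such
  a triangle \<open>M \<bullet> A - k = r \<bar>A\<bar> > 0\<close> and \<open>A \<bullet> A - k > 0\<close>, so \<open>M\<close> and \<open>A\<close> are on the
  same side of \<open>B C\<close>; by symmetry \<open>M\<close> is inside, and the circle is the incircle.
\<close>

section \<open>Lines in the plane\<close>

lemma affine_hull_2_eq_line:
  fixes P Q n :: point
  assumes "P \<noteq> Q" "n \<noteq> 0" "n \<bullet> P = d" "n \<bullet> Q = d"
  shows "affine hull {P, Q} = {X. n \<bullet> X = d}"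
proof (rule affine_dim_equal)
  show "affine hull {P, Q} \<subseteq> {X. n \<bullet> X = d}"
    using assms by (intro hull_minimal) (auto simp: affine_hyperplane)
  show "aff_dim (affine hull {P, Q}) = aff_dim {X. n \<bullet> X = d}"
    using assms by (simp add: aff_dim_2)
qed (auto simp: affine_hyperplane)

lemma affine_hull_2_is_line:
  fixes P Q :: point
  assumes "P \<noteq> Q"
  obtains n where "n \<noteq> 0" "affine hull {P, Q} = {X. n \<bullet> X = n \<bullet> P}"
proof -
  define n :: point where "n = vector [P$2 - Q$2, Q$1 - P$1]"
  have "n \<noteq> 0"
    using assms by (auto simp: n_def vec_eq_iff forall_2)
  moreover have "n \<bullet> Q = n \<bullet> P"
    by (simp add: n_def inner_vec_def sum_2 algebra_simps)
  ultimately show ?thesis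
    using that affine_hull_2_eq_line[OF assms \<open>n \<noteq> 0\<close> refl] by blast
qed

text \<open>A single common point means tangency: by Pythagoras, the reflection in the foot of the
  perpendicular from \<open>M\<close> maps the intersection to itself, so a single point must be that foot,
  and its distance from \<open>M\<close> is the radius.\<close>

lemma hyperplane_tangent_sphere_iff:
  fixes M n :: "'a::euclidean_space"
  assumes "n \<noteq> 0" "0 < r"
  shows "(\<exists>T. {X. n \<bullet> X = d} \<inter> sphere M r = {T}) \<longleftrightarrow> \<bar>d - n \<bullet> M\<bar> = r * norm n"
proof -
  define F where "F = M + ((d - n \<bullet> M) / (n \<bullet> n)) *\<^sub>R n"
  have nn: "n \<bullet> n > 0" using assms by simp
  have F: "n \<bullet> F = d"
    using nn by (simp add: F_def inner_add_right)
  have dF: "dist M F = \<bar>d - n \<bullet> M\<bar> / norm n"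
  proof -
    have "n \<bullet> n = norm n * norm n" by (simp add: dot_square_norm power2_eq_square)
    then show ?thesis using assms by (simp add: F_def dist_norm)
  qed
  have pyth: "(dist M X)\<^sup>2 = (dist M F)\<^sup>2 + (dist F X)\<^sup>2" if "n \<bullet> X = d" for X
  proof -
    have "n \<bullet> (F - X) = 0" using that F by (simp add: inner_diff_right)
    moreover have "M - F = - ((d - n \<bullet> M) / (n \<bullet> n)) *\<^sub>R n" by (simp add: F_def)
    ultimately have "(M - F) \<bullet> (F - X) = 0" by (simp only: inner_scaleR_left mult_zero_right)
    then have "(norm ((M - F) + (F - X)))\<^sup>2 = (norm (M - F))\<^sup>2 + (norm (F - X))\<^sup>2"
      by (intro norm_add_Pythagorean) (simp add: orthogonal_def)
    then show ?thesis by (simp add: dist_norm)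
  qed
  have "(\<exists>T. {X. n \<bullet> X = d} \<inter> sphere M r = {T}) \<longleftrightarrow> dist M F = r"
  proof
    assume "\<exists>T. {X. n \<bullet> X = d} \<inter> sphere M r = {T}"
    then obtain T where T: "{X. n \<bullet> X = d} \<inter> sphere M r = {T}" by blast
    then have T': "n \<bullet> T = d" "dist M T = r" by auto
    \<comment> \<open>The mirror image of \<open>T\<close> in the foot \<open>F\<close> is again on both, so \<open>T\<close> is the foot.\<close>
    define S where "S = 2 *\<^sub>R F - T"
    have S: "n \<bullet> S = d"
      using F T' by (simp add: S_def inner_diff_right)
    have "F - S = T - F" by (simp add: S_def scaleR_2)
    then have "dist F S = dist F T"
      by (simp add: dist_norm norm_minus_commute)
    then have "(dist M S)\<^sup>2 = (dist M T)\<^sup>2"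
      using pyth[OF S] pyth[OF T'(1)] by simp
    then have "dist M S = r" using T'(2) assms(2) by (simp add: power2_eq_iff_nonneg)
    then have "S \<in> {X. n \<bullet> X = d} \<inter> sphere M r" using S by simp
    then have "S = T" using T by simp
    then have "2 *\<^sub>R F = 2 *\<^sub>R T" by (simp add: S_def scaleR_2 algebra_simps)
    then have "F = T" by simp
    then show "dist M F = r" using T'(2) by simp
  next
    assume r: "dist M F = r"
    have "X = F" if "X \<in> {X. n \<bullet> X = d} \<inter> sphere M r" for X
      using pyth[of X] that r by simp
    moreover have "F \<in> {X. n \<bullet> X = d} \<inter> sphere M r" using F r by simp
    ultimately have "{X. n \<bullet> X = d} \<inter> sphere M r = {F}" by blast
    then show "\<exists>T. {X. n \<bullet> X = d} \<inter> sphere M r = {T}" by blast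
  qed
  also have "\<dots> \<longleftrightarrow> \<bar>d - n \<bullet> M\<bar> = r * norm n"
    using assms by (simp add: dF field_simps)
  finally show ?thesis .
qed

section \<open>A conic seen from its focus\<close>

locale focal_conic =
  fixes F e :: point and p :: real
  assumes p_pos: "0 < p" and e_less: "norm e < 1"
begin

definition locus :: "point set" where
  "locus = {X. norm (X - F) = p - e \<bullet> (X - F)}"

text \<open>The value \<open>k = - radius * p\<close> at which the polars of the points of the conic touch the
  circle, for the radius at which the triangles close up.\<close>

definition polar_const :: real where
  "polar_const = - p\<^sup>2 / (2 - e \<bullet> e)"

definition radius :: real where
  "radius = p / (2 - e \<bullet> e)"

definition center :: point where
  "center = F - radius *\<^sub>R e"

lemma e_square_less: "e \<bullet> e < 1"
  using e_less by (simp add: norm_lt_square)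

lemma radius_pos: "0 < radius"
  using p_pos e_square_less by (simp add: radius_def)

lemma polar_const_eq: "polar_const = - radius * p"
  by (simp add: polar_const_def radius_def power2_eq_square)

lemma polar_const_neg: "polar_const < 0"
  using radius_pos p_pos by (simp add: polar_const_eq)

lemma focal_distance_pos: "X \<in> locus \<Longrightarrow> 0 < norm (X - F)"
  using p_pos by (cases "X = F") (simp add: locus_def, simp)

text \<open>The second branch \<open>\<bar>X\<bar> = e \<bullet> X - p\<close> that squaring might add is empty, because
  \<open>e \<bullet> X \<le> \<bar>X\<bar>\<close> and \<open>p > 0\<close>.\<close>

lemma locus_iff_square:
  "X \<in> locus \<longleftrightarrow> (norm (X - F))\<^sup>2 = (p - e \<bullet> (X - F))\<^sup>2"
proof -
  have "e \<bullet> (X - F) \<le> norm e * norm (X - F)"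
    by (rule norm_cauchy_schwarz)
  also have "\<dots> \<le> norm (X - F)"
    using e_less by (intro mult_left_le_one_le) auto
  finally have "norm (X - F) \<noteq> - (p - e \<bullet> (X - F))"
    using p_pos by simp
  then show ?thesis
    by (auto simp: locus_def power2_eq_iff)
qed

subsection \<open>Polar lines\<close>

definition polar :: "point \<Rightarrow> point set" where
  "polar N = {X. (N - F) \<bullet> (X - F) = polar_const}"

lemma polar_eq: "polar N = {X. (N - F) \<bullet> X = polar_const + (N - F) \<bullet> F}"
  by (auto simp: polar_def inner_diff_right)

text \<open>The distance of the polar of \<open>N\<close> from the center is
  \<open>radius * \<bar>p - e \<bullet> (N - F)\<bar> / norm (N - F)\<close>; tangency is thus the squared focal equation
  for \<open>N\<close>.\<close>

lemma polar_tangent_iff: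
  assumes "N \<noteq> F"
  shows "(\<exists>T. polar N \<inter> sphere center radius = {T}) \<longleftrightarrow> N \<in> locus"
proof -
  have "(\<exists>T. polar N \<inter> sphere center radius = {T}) \<longleftrightarrow>
     \<bar>polar_const + (N - F) \<bullet> F - (N - F) \<bullet> center\<bar> = radius * norm (N - F)"
    unfolding polar_eq using assms radius_pos by (intro hyperplane_tangent_sphere_iff) auto
  also have "polar_const + (N - F) \<bullet> F - (N - F) \<bullet> center = - radius * (p - e \<bullet> (N - F))"
    by (simp add: polar_const_eq center_def inner_diff_right inner_commute algebra_simps)
  also have "\<bar>- radius * (p - e \<bullet> (N - F))\<bar> = radius * norm (N - F) \<longleftrightarrow>
     \<bar>p - e \<bullet> (N - F)\<bar> = norm (N - F)"
    using radius_pos by (simp add: abs_mult)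
  also have "\<dots> \<longleftrightarrow> N \<in> locus"
    unfolding locus_iff_square power2_eq_iff using norm_ge_zero[of "N - F"]
    by (auto simp: abs_if simp del: norm_ge_zero)
  finally show ?thesis .
qed

text \<open>Every line that avoids \<open>F\<close> is the polar of a multiple of its normal vector, based at \<open>F\<close>.\<close>

lemma tangent_is_polar:
  assumes "P \<noteq> Q" "line_tangent_to_circle P Q center radius"
  obtains N where "N \<in> locus" "affine hull {P, Q} = polar N"
proof -
  obtain n where n: "n \<noteq> 0" "affine hull {P, Q} = {X. n \<bullet> X = n \<bullet> P}"
    using affine_hull_2_is_line[OF assms(1)] .
  define d where "d = n \<bullet> (P - F)"
  have d: "\<bar>d + radius * (n \<bullet> e)\<bar> = radius * norm n"
    using assms(2) hyperplane_tangent_sphere_iff[OF n(1) radius_pos, of "n \<bullet> P" center] n(2)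
    by (simp add: line_tangent_to_circle_def d_def center_def inner_diff_right)
  \<comment> \<open>The focus lies inside the circle, hence on no tangent.\<close>
  have "d \<noteq> 0"
  proof
    assume "d = 0"
    then have "\<bar>n \<bullet> e\<bar> = norm n"
      using d radius_pos by (simp add: abs_mult)
    moreover have "norm n * norm e < norm n"
      using n(1) e_less by simp
    ultimately show False
      using Cauchy_Schwarz_ineq2[of n e] by linarith
  qed
  define N where "N = F + (polar_const / d) *\<^sub>R n"
  have "X \<in> polar N \<longleftrightarrow> n \<bullet> X = n \<bullet> P" for X
  proof -
    have "X \<in> polar N \<longleftrightarrow> polar_const * (n \<bullet> (X - F)) / d = polar_const"
      by (simp add: polar_def N_def)
    also have "\<dots> \<longleftrightarrow> n \<bullet> (X - F) = d"
      using \<open>d \<noteq> 0\<close> polar_const_neg by (simp add: divide_eq_eq)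
    also have "\<dots> \<longleftrightarrow> n \<bullet> X = n \<bullet> P"
      by (simp add: d_def inner_diff_right)
    finally show ?thesis .
  qed
  then have "affine hull {P, Q} = polar N"
    by (auto simp: n(2))
  moreover have "N \<noteq> F"
    using n(1) \<open>d \<noteq> 0\<close> polar_const_neg by (simp add: N_def)
  ultimately show ?thesis
    using that polar_tangent_iff[of N] assms(2) by (auto simp: line_tangent_to_circle_def)
qed

lemma polar_chord:
  assumes "A \<in> locus" "P \<noteq> Q" "P \<in> polar A" "Q \<in> polar A"
  shows "affine hull {P, Q} = polar A"
proof -
  have "A - F \<noteq> 0" using focal_distance_pos[OF assms(1)] by simp
  then show ?thesis
    using affine_hull_2_eq_line[OF assms(2)] assms(3,4) unfolding polar_eq by blast
qed

lemma polar_chord_tangent: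
  assumes "A \<in> locus" "P \<noteq> Q" "P \<in> polar A" "Q \<in> polar A"
  shows "line_tangent_to_circle P Q center radius"
  using polar_chord[OF assms] polar_tangent_iff[of A] focal_distance_pos[OF assms(1)] assms(1)
  by (auto simp: line_tangent_to_circle_def)

subsection \<open>Closure\<close>

definition perp :: "point \<Rightarrow> point" where
  "perp v = vector [- v $ 2, v $ 1]"

text \<open>Parseval's identity for the orthogonal frame \<open>v\<close>, \<open>perp v\<close>, with denominators cleared.\<close>

lemma inner_perp_frame:
  "(v \<bullet> v) * (x \<bullet> y) = (x \<bullet> v) * (y \<bullet> v) + (x \<bullet> perp v) * (y \<bullet> perp v)"
  by (simp add: perp_def inner_vec_def sum_2 algebra_simps)

text \<open>On the polar of \<open>A\<close> the component along \<open>A\<close> is fixed, so the position is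
  given by the component \<open>t\<close> along \<open>perp (A - F)\<close>, and the equation of the conic
  becomes a monic quadratic in \<open>t\<close>.  What matters is its constant term, that is, the product of
  the roots; it takes this simple form because of the value of \<open>polar_const\<close>.\<close>

lemma polar_locus_quadratic:
  assumes "A \<in> locus"
  obtains \<beta> where "\<And>X. X \<in> polar A \<Longrightarrow> X \<in> locus \<longleftrightarrow>
    ((X - F) \<bullet> perp (A - F))\<^sup>2 + 2 * \<beta> * ((X - F) \<bullet> perp (A - F))
      + polar_const * ((norm (A - F))\<^sup>2 - polar_const) = 0"
proof -
  define v where "v = A - F"
  define R where "R = norm v"
  define g where "g = e \<bullet> v"
  define h where "h = e \<bullet> perp v"
  define k where "k = polar_const"
  have R: "0 < R" using focal_distance_pos[OF assms] by (simp add: R_def v_def)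
  have vv: "v \<bullet> v = R\<^sup>2" by (simp add: R_def dot_square_norm)
  have g: "g = p - R" using assms by (simp add: locus_def g_def R_def v_def)
  have h: "h\<^sup>2 = R\<^sup>2 * (e \<bullet> e) - g\<^sup>2"
    using inner_perp_frame[of v e e] by (simp add: vv g_def h_def power2_eq_square)
  have k: "k * (2 - e \<bullet> e) = - p\<^sup>2"
    using e_square_less by (simp add: k_def polar_const_def)
  define \<alpha> where "\<alpha> = R\<^sup>2 - h\<^sup>2"
  have "R\<^sup>2 * (e \<bullet> e) < R\<^sup>2" using R e_square_less by simp
  then have \<alpha>: "0 < \<alpha>" unfolding \<alpha>_def h using zero_le_power2[of g] by linarith
  \<comment> \<open>The difference of the two sides is a multiple of \<open>k * (2 - e \<bullet> e) + p\<^sup>2\<close>.\<close>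
  have const: "k\<^sup>2 * R\<^sup>2 - (p * R\<^sup>2 - k * g)\<^sup>2 = \<alpha> * (k * (R\<^sup>2 - k))"
  proof -
    have "k\<^sup>2 * R\<^sup>2 - (p * R\<^sup>2 - k * g)\<^sup>2 - \<alpha> * (k * (R\<^sup>2 - k))
      = - (k * (2 - e \<bullet> e) + p\<^sup>2) * (R\<^sup>2 * (R\<^sup>2 - k))"
      unfolding \<alpha>_def h g by algebra
    then show ?thesis by (simp add: k)
  qed
  show ?thesis
  proof (rule that[of "h * (p * R\<^sup>2 - k * g) / \<alpha>"])
    fix X assume X: "X \<in> polar A"
    define t where "t = (X - F) \<bullet> perp v"
    have Xv: "(X - F) \<bullet> v = k"
      using X by (simp add: polar_def v_def k_def inner_commute)
    have n: "R\<^sup>2 * (norm (X - F))\<^sup>2 = k\<^sup>2 + t\<^sup>2"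
      using inner_perp_frame[of v "X - F" "X - F"]
      unfolding dot_square_norm vv Xv t_def[symmetric] by (simp add: R_def dot_square_norm power2_eq_square)
    have eX: "R\<^sup>2 * (e \<bullet> (X - F)) = g * k + h * t"
      using inner_perp_frame[of v e "X - F"] by (simp add: vv Xv t_def g_def h_def)
    have "X \<in> locus \<longleftrightarrow> (norm (X - F))\<^sup>2 = (p - e \<bullet> (X - F))\<^sup>2"
      by (rule locus_iff_square)
    also have "\<dots> \<longleftrightarrow> R\<^sup>2 * (R\<^sup>2 * (norm (X - F))\<^sup>2) = R\<^sup>2 * (R\<^sup>2 * (p - e \<bullet> (X - F))\<^sup>2)"
      using R by simp
    also have "R\<^sup>2 * (R\<^sup>2 * (p - e \<bullet> (X - F))\<^sup>2) = (R\<^sup>2 * p - R\<^sup>2 * (e \<bullet> (X - F)))\<^sup>2"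
      by algebra
    also have "R\<^sup>2 * (R\<^sup>2 * (norm (X - F))\<^sup>2) = (R\<^sup>2 * p - R\<^sup>2 * (e \<bullet> (X - F)))\<^sup>2 \<longleftrightarrow>
      \<alpha> * t\<^sup>2 + 2 * h * (p * R\<^sup>2 - k * g) * t + (k\<^sup>2 * R\<^sup>2 - (p * R\<^sup>2 - k * g)\<^sup>2) = 0"
      unfolding n eX \<alpha>_def by algebra
    also have "\<alpha> * t\<^sup>2 + 2 * h * (p * R\<^sup>2 - k * g) * t + (k\<^sup>2 * R\<^sup>2 - (p * R\<^sup>2 - k * g)\<^sup>2)
      = \<alpha> * (t\<^sup>2 + 2 * (h * (p * R\<^sup>2 - k * g) / \<alpha>) * t + k * (R\<^sup>2 - k))"
      unfolding const using \<alpha> by (simp add: field_simps)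
    finally show "X \<in> locus \<longleftrightarrow>
      ((X - F) \<bullet> perp (A - F))\<^sup>2
        + 2 * (h * (p * R\<^sup>2 - k * g) / \<alpha>) * ((X - F) \<bullet> perp (A - F))
        + polar_const * ((norm (A - F))\<^sup>2 - polar_const) = 0"
      using \<alpha> by (simp add: t_def v_def R_def k_def)
  qed
qed

text \<open>The closure property: with \<open>t\<close> as in the quadratic, and the focus as origin,
  \<open>\<bar>A\<bar>\<^sup>2 (P \<bullet> Q) = k\<^sup>2 + t\<^sub>P t\<^sub>Q = k\<^sup>2 + k (\<bar>A\<bar>\<^sup>2 - k) = \<bar>A\<bar>\<^sup>2 k\<close>
  by Vieta's formula.\<close>

lemma conjugate_of_polar_chord:
  assumes "A \<in> locus" "P \<in> locus" "Q \<in> locus" "P \<noteq> Q" "P \<in> polar A" "Q \<in> polar A"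
  shows "Q \<in> polar P"
proof -
  define v where "v = A - F"
  define t where "t = (\<lambda>X. (X - F) \<bullet> perp v)"
  define R2 where "R2 = (norm v)\<^sup>2"
  have R2: "v \<bullet> v = R2" "0 < R2"
    using focal_distance_pos[OF assms(1)] by (simp_all add: R2_def v_def dot_square_norm)
  have pv: "(P - F) \<bullet> v = polar_const" and qv: "(Q - F) \<bullet> v = polar_const"
    using assms(5,6) by (simp_all add: polar_def v_def inner_commute)
  have "t P \<noteq> t Q"
  proof
    assume "t P = t Q"
    then have "(P - Q) \<bullet> perp v = 0" by (simp add: t_def inner_diff_left)
    moreover have "(P - Q) \<bullet> v = 0"
      using pv qv by (simp add: inner_diff_left)
    ultimately have "R2 * ((P - Q) \<bullet> (P - Q)) = 0"
      using inner_perp_frame[of v "P - Q" "P - Q"] R2(1) by simp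
    then show False using R2 assms(4) by simp
  qed
  obtain \<beta> where \<beta>: "\<And>X. X \<in> polar A \<Longrightarrow> X \<in> locus \<longleftrightarrow>
      (t X)\<^sup>2 + 2 * \<beta> * t X + polar_const * (R2 - polar_const) = 0"
    using polar_locus_quadratic[OF assms(1)] unfolding t_def v_def R2_def by blast
  have "(t P)\<^sup>2 + 2 * \<beta> * t P + polar_const * (R2 - polar_const) = 0"
    "(t Q)\<^sup>2 + 2 * \<beta> * t Q + polar_const * (R2 - polar_const) = 0"
    using \<beta> assms by blast+
  \<comment> \<open>Vieta's formula for the product, by eliminating \<open>\<beta>\<close> from the two equations.\<close>
  then have "(t P - t Q) * (t P * t Q - polar_const * (R2 - polar_const)) = 0" by algebra
  then have prod: "t P * t Q = polar_const * (R2 - polar_const)" using \<open>t P \<noteq> t Q\<close> by simp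
  have "R2 * ((P - F) \<bullet> (Q - F)) = polar_const * polar_const + t P * t Q"
    using inner_perp_frame[of v "P - F" "Q - F"] by (simp add: R2(1) pv qv t_def)
  also have "\<dots> = R2 * polar_const" unfolding prod by algebra
  finally show ?thesis using R2(2) by (simp add: polar_def)
qed

text \<open>The product of the roots is negative since \<open>polar_const < 0\<close>, so there are two distinct
  real roots.\<close>

lemma polar_meets_locus_twice:
  assumes "A \<in> locus"
  obtains P Q where "P \<in> locus" "Q \<in> locus" "P \<noteq> Q" "P \<in> polar A" "Q \<in> polar A"
proof -
  define v where "v = A - F"
  define t where "t = (\<lambda>X. (X - F) \<bullet> perp v)"
  define R2 where "R2 = (norm v)\<^sup>2"
  have R2: "v \<bullet> v = R2" "0 < R2"
    using focal_distance_pos[OF assms(1)] by (simp_all add: R2_def v_def dot_square_norm)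
  have perp: "perp v \<bullet> v = 0" "v \<bullet> perp v = 0" "perp v \<bullet> perp v = v \<bullet> v"
    by (simp_all add: perp_def inner_vec_def sum_2)
  obtain \<beta> where \<beta>: "\<And>X. X \<in> polar A \<Longrightarrow> X \<in> locus \<longleftrightarrow>
      (t X)\<^sup>2 + 2 * \<beta> * t X + polar_const * (R2 - polar_const) = 0"
    using polar_locus_quadratic[OF assms(1)] unfolding t_def v_def R2_def by blast
  define D where "D = \<beta>\<^sup>2 - polar_const * (R2 - polar_const)"
  have "polar_const * (R2 - polar_const) < 0"
    using polar_const_neg R2(2) by (simp add: mult_less_0_iff)
  then have D: "0 < D" unfolding D_def using zero_le_power2[of \<beta>] by linarith
  define X where "X = (\<lambda>\<tau>. F + (1 / R2) *\<^sub>R (polar_const *\<^sub>R v + \<tau> *\<^sub>R perp v))"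
  have Xpol: "X \<tau> \<in> polar A" for \<tau>
  proof -
    have "(X \<tau> - F) \<bullet> v = polar_const"
      using R2 perp by (simp add: X_def inner_add_left)
    then show ?thesis by (simp add: polar_def v_def inner_commute)
  qed
  have tX: "t (X \<tau>) = \<tau>" for \<tau>
    using R2 perp by (simp add: X_def t_def inner_add_left)
  have root: "X (- \<beta> + s) \<in> locus" if "s\<^sup>2 = D" for s
    unfolding \<beta>[OF Xpol] tX using that unfolding D_def by algebra
  show ?thesis
  proof (rule that)
    show "X (- \<beta> + sqrt D) \<in> locus" "X (- \<beta> + - sqrt D) \<in> locus"
      using D by (intro root; simp)+
    show "X (- \<beta> + sqrt D) \<noteq> X (- \<beta> + - sqrt D)"
    proof
      assume "X (- \<beta> + sqrt D) = X (- \<beta> + - sqrt D)"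
      then have "- \<beta> + sqrt D = - \<beta> + - sqrt D" by (metis tX)
      then show False using D by simp
    qed
  qed (rule Xpol)+
qed

lemma tangent_chord_conjugate:
  assumes "P \<in> locus" "Q \<in> locus" "P \<noteq> Q" "line_tangent_to_circle P Q center radius"
  shows "(P - F) \<bullet> (Q - F) = polar_const"
proof -
  obtain N where N: "N \<in> locus" "affine hull {P, Q} = polar N"
    using tangent_is_polar assms(3,4) by blast
  then have "P \<in> polar N" "Q \<in> polar N"
    by (metis hull_inc insertCI)+
  then show ?thesis
    using conjugate_of_polar_chord N(1) assms by (auto simp: polar_def)
qed

subsection \<open>The Poncelet family\<close>

lemma poncelet_family_conjugate:
  assumes "(A, B, C) \<in> poncelet_family locus center radius"
  shows "(A - F) \<bullet> (B - F) = polar_const" "(B - F) \<bullet> (C - F) = polar_const" "(C - F) \<bullet> (A - F) = polar_const"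
proof -
  have "A \<noteq> B" "B \<noteq> C" "C \<noteq> A"
    using assms by (auto simp: poncelet_family_def insert_commute)
  then show "(A - F) \<bullet> (B - F) = polar_const" "(B - F) \<bullet> (C - F) = polar_const" "(C - F) \<bullet> (A - F) = polar_const"
    using assms by (auto simp: poncelet_family_def sidelines_tangent_def
        intro: tangent_chord_conjugate)
qed

text \<open>The triangle through \<open>A\<close> is cut out by the polar of \<open>A\<close>.  It is self-polar by the closure
  property, and nondegenerate because no point lies on its own polar, \<open>polar_const\<close> being
  negative.\<close>

theorem is_caustic_locus: "is_caustic locus center radius"
  unfolding is_caustic_def
proof (intro conjI ballI)
  show "0 < radius" by (rule radius_pos)
  fix A assume A: "A \<in> locus"
  obtain B C where BC: "B \<in> locus" "C \<in> locus" "B \<noteq> C" "B \<in> polar A" "C \<in> polar A"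
    using polar_meets_locus_twice[OF A] .
  have CB: "C \<in> polar B"
    using conjugate_of_polar_chord[OF A] BC by blast
  have sym: "X \<in> polar Y \<longleftrightarrow> Y \<in> polar X" for X Y
    by (simp add: polar_def inner_commute)
  have notself: "X \<notin> polar X" for X
    using polar_const_neg inner_ge_zero[of "X - F"] unfolding polar_def mem_Collect_eq by linarith
  have neq: "A \<noteq> B" "C \<noteq> A" using BC notself by blast+
  have "\<not> collinear {B, C, A}"
    using polar_chord[OF A BC(3-5)] notself[of A] collinear_3_affine_hull[OF BC(3)] by auto
  then have "\<not> collinear {A, B, C}" by (simp add: insert_commute)
  moreover have "sidelines_tangent center radius A B C"
    unfolding sidelines_tangent_def
    using polar_chord_tangent[OF A BC(3-5)] polar_chord_tangent[OF BC(2) neq(1)]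
      polar_chord_tangent[OF BC(1) neq(2)] sym BC CB by blast
  ultimately have "(A, B, C) \<in> poncelet_family locus center radius"
    using A BC by (simp add: poncelet_family_def)
  then show "\<exists>(A', B, C) \<in> poncelet_family locus center radius. A \<in> {A', B, C}"
    by blast
qed

text \<open>Equal inner products of the vertices, taken from \<open>F\<close>, say that \<open>F\<close> lies on all altitudes.
  Another common point \<open>P\<close> would give three vertices with the same component along
  \<open>P - F\<close>, hence collinear.\<close>

theorem stationary_orthocenter_focus:
  "stationary_at is_orthocenter (poncelet_family locus center radius) F"
  unfolding stationary_at_def
proof clarify
  fix A B C assume ABC: "(A, B, C) \<in> poncelet_family locus center radius"
  note k = poncelet_family_conjugate[OF ABC]
  have col: "\<not> collinear {A, B, C}" using ABC by (simp add: poncelet_family_def)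
  have "F \<in> altitude A B C \<inter> altitude B C A \<inter> altitude C A B"
    using k by (simp add: altitude_def inner_commute algebra_simps)
  moreover have "P = F" if "P \<in> altitude A B C \<inter> altitude B C A \<inter> altitude C A B" for P
  proof (rule ccontr)
    assume "P \<noteq> F"
    define n where "n = P - F"
    have n: "n \<noteq> 0" "n \<bullet> A = n \<bullet> B" "n \<bullet> A = n \<bullet> C"
      using k that \<open>P \<noteq> F\<close>
      by (simp_all add: n_def altitude_def inner_commute algebra_simps)
    have "A \<noteq> B" using col by auto
    then have "affine hull {A, B} = {X. n \<bullet> X = n \<bullet> A}"
      by (rule affine_hull_2_eq_line[OF _ n(1) refl n(2)[symmetric]])
    then have "C \<in> affine hull {A, B}" unfolding n(3) by simp
    then show False using col collinear_3_affine_hull[OF \<open>A \<noteq> B\<close>] by blast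
  qed
  ultimately show "is_orthocenter F A B C"
    unfolding is_orthocenter_def by blast
qed

text \<open>Pairing \<open>center = u A + v B + w C\<close>, taken from \<open>F\<close>, with \<open>A\<close> and
  using that the mixed products are \<open>k\<close> gives \<open>center \<bullet> A - k = u (A \<bullet> A - k)\<close>.  Both
  differences are positive, hence so is \<open>u\<close>, and likewise the other barycentric coordinates.\<close>

theorem is_incircle_poncelet_family:
  assumes ABC: "(A, B, C) \<in> poncelet_family locus center radius"
  shows "is_incircle center radius A B C"
proof -
  note k = poncelet_family_conjugate[OF ABC]
  have col: "\<not> collinear {A, B, C}" and tan: "sidelines_tangent center radius A B C"
    and mem: "A \<in> locus" "B \<in> locus" "C \<in> locus"
    using ABC by (simp_all add: poncelet_family_def)
  have indep: "\<not> affine_dependent {A, B, C}"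
    using col by (simp add: collinear_3_eq_affine_dependent)
  have "card {A, B, C} = 3" using col by (auto simp: card_insert_if insert_commute)
  then have "affine hull {A, B, C} = UNIV"
    using affine_independent_span_eq[OF indep] by simp
  then have "center \<in> affine hull {A, B, C}" by simp
  then obtain u v w where uvw: "u + v + w = 1" "center = u *\<^sub>R A + v *\<^sub>R B + w *\<^sub>R C"
    unfolding affine_hull_3 by blast
  have "center - F = u *\<^sub>R A + v *\<^sub>R B + w *\<^sub>R C - (u + v + w) *\<^sub>R F"
    by (simp add: uvw)
  then have cF: "center - F = u *\<^sub>R (A - F) + v *\<^sub>R (B - F) + w *\<^sub>R (C - F)"
    by (simp add: algebra_simps)
  have side: "polar_const < (center - F) \<bullet> (X - F)" if "X \<in> locus" for X
  proof -
    have "(center - F) \<bullet> (X - F) - polar_const = radius * (p - e \<bullet> (X - F))"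
      unfolding center_def polar_const_eq by (simp add: algebra_simps)
    also have "\<dots> = radius * norm (X - F)"
      using that by (simp add: locus_def)
    finally have "(center - F) \<bullet> (X - F) - polar_const = radius * norm (X - F)" .
    then show ?thesis
      using radius_pos focal_distance_pos[OF that] by (metis diff_gt_0_iff_gt mult_pos_pos)
  qed
  have pos: "0 < x" if "(center - F) \<bullet> (X - F) - polar_const = x * ((X - F) \<bullet> (X - F) - polar_const)"
    "X \<in> locus" for x X
  proof -
    have "0 < (X - F) \<bullet> (X - F) - polar_const"
      using polar_const_neg inner_ge_zero[of "X - F"] by linarith
    moreover have "0 < x * ((X - F) \<bullet> (X - F) - polar_const)"
      using side[OF that(2)] that(1) by simp
    ultimately show ?thesis by (simp add: zero_less_mult_iff)
  qed
  have k': "(B - F) \<bullet> (A - F) = polar_const" "(C - F) \<bullet> (B - F) = polar_const" "(A - F) \<bullet> (C - F) = polar_const"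
    using k by (simp_all add: inner_commute)
  have w: "w = 1 - u - v" using uvw(1) by simp
  have dots:
    "(center - F) \<bullet> (A - F) = u * ((A - F) \<bullet> (A - F)) + v * polar_const + w * polar_const"
    "(center - F) \<bullet> (B - F) = u * polar_const + v * ((B - F) \<bullet> (B - F)) + w * polar_const"
    "(center - F) \<bullet> (C - F) = u * polar_const + v * polar_const + w * ((C - F) \<bullet> (C - F))"
    unfolding cF inner_add_left inner_scaleR_left k k' by (rule refl)+
  have "0 < u"
    by (rule pos[OF _ mem(1)], unfold dots w) algebra
  moreover have "0 < v"
    by (rule pos[OF _ mem(2)], unfold dots w) algebra
  moreover have "0 < w"
    by (rule pos[OF _ mem(3)], unfold dots w) algebra
  ultimately have "center \<in> interior (convex hull {A, B, C})"
    using uvw interior_convex_hull_3_minimal[OF col] by auto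
  then show ?thesis
    using tan radius_pos by (simp add: is_incircle_def)
qed

end

section \<open>The ellipse\<close>

text \<open>The focal equation of the ellipse, squared: the distance from the focus \<open>[f, 0]\<close> is
  \<open>a - f x / a\<close>.  As only \<open>f\<^sup>2\<close> is prescribed, \<open>f\<close> may be either focus.\<close>

lemma ellipse_eq_focal:
  fixes a b f :: real
  assumes "0 < b" "b < a" "f\<^sup>2 = a\<^sup>2 - b\<^sup>2"
  shows "X \<in> ellipse a b \<longleftrightarrow>
    (norm (X - vector [f, 0]))\<^sup>2 = (b\<^sup>2 / a - vector [f / a, 0] \<bullet> (X - vector [f, 0]))\<^sup>2"
proof -
  define x y where "x = X $ 1" and "y = X $ 2"
  have "b\<^sup>2 / a - f / a * (x - f) = (a\<^sup>2 - f * x) / a"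
    using assms by (simp add: field_simps power2_eq_square)
  then have "(norm (X - vector [f, 0]))\<^sup>2 = (b\<^sup>2 / a - vector [f / a, 0] \<bullet> (X - vector [f, 0]))\<^sup>2
    \<longleftrightarrow> (x - f)\<^sup>2 + y\<^sup>2 = ((a\<^sup>2 - f * x) / a)\<^sup>2"
    unfolding power2_norm_eq_inner
    by (simp add: inner_vec_def sum_2 x_def y_def flip: power2_eq_square)
  also have "\<dots> \<longleftrightarrow> a\<^sup>2 * ((x - f)\<^sup>2 + y\<^sup>2) = (a\<^sup>2 - f * x)\<^sup>2"
    using assms by (auto simp: power_divide field_simps)
  also have "\<dots> \<longleftrightarrow> b\<^sup>2 * x\<^sup>2 + a\<^sup>2 * y\<^sup>2 = a\<^sup>2 * b\<^sup>2"
  proof -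
    have "a\<^sup>2 * ((x - f)\<^sup>2 + y\<^sup>2) - (a\<^sup>2 - f * x)\<^sup>2 = b\<^sup>2 * x\<^sup>2 + a\<^sup>2 * y\<^sup>2 - a\<^sup>2 * b\<^sup>2"
      using assms(3) by algebra
    then show ?thesis by linarith
  qed
  also have "\<dots> \<longleftrightarrow> X \<in> ellipse a b"
    using assms by (auto simp: ellipse_def x_def y_def field_simps)
  finally show ?thesis by simp
qed

theorem proposition5:
  fixes a b c r s :: real and M :: point
  assumes "0 < b" "b < a"
    and "c = sqrt (a\<^sup>2 - b\<^sup>2)"
    and "s = 1 \<or> s = - 1"
    and "M = vector [s * (a\<^sup>2 * c / (2 * a\<^sup>2 - c\<^sup>2)), 0]"
    and "r = a * (a\<^sup>2 - c\<^sup>2) / (2 * a\<^sup>2 - c\<^sup>2)"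
  shows "is_caustic (ellipse a b) M r
    \<and> (\<forall>(A, B, C) \<in> poncelet_family (ellipse a b) M r. is_incircle M r A B C)
    \<and> stationary_at is_orthocenter (poncelet_family (ellipse a b) M r) (vector [s * c, 0])"
proof -
  have a: "0 < a" using assms by simp
  have "b\<^sup>2 < a\<^sup>2" using assms by (simp add: power_strict_mono)
  then have c2: "c\<^sup>2 = a\<^sup>2 - b\<^sup>2" using assms(3) by simp
  define f where "f = s * c"
  have f2: "f\<^sup>2 = a\<^sup>2 - b\<^sup>2" using assms(4) c2 by (auto simp: f_def)
  define F e :: point where "F = vector [f, 0]" and "e = vector [f / a, 0]"
  have ee: "e \<bullet> e = (a\<^sup>2 - b\<^sup>2) / a\<^sup>2"
    using f2 by (simp add: e_def inner_vec_def sum_2 power2_eq_square)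
  interpret focal_conic F e "b\<^sup>2 / a"
  proof
    show "0 < b\<^sup>2 / a" using assms(1) a by simp
    show "norm e < 1" using assms(1) a by (simp add: norm_lt_square ee)
  qed
  have E: "locus = ellipse a b"
    using ellipse_eq_focal[OF assms(1,2) f2] locus_iff_square by (auto simp: F_def e_def)
  have den: "0 < a\<^sup>2 + b\<^sup>2" using a by (simp add: add_pos_nonneg)
  have rad: "radius = a * b\<^sup>2 / (a\<^sup>2 + b\<^sup>2)"
  proof -
    have "2 - e \<bullet> e = (a\<^sup>2 + b\<^sup>2) / a\<^sup>2" using a by (simp add: ee field_simps)
    then show ?thesis unfolding radius_def using a den by (simp add: power2_eq_square)
  qed
  have r: "r = radius" using assms(6) by (simp add: rad c2)
  have "f - radius * (f / a) = s * (a\<^sup>2 * c / (2 * a\<^sup>2 - c\<^sup>2))"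
    using a den by (simp add: rad c2 f_def field_simps)
  then have "M = F - radius *\<^sub>R e"
    by (simp add: assms(5) F_def e_def vec_eq_iff forall_2)
  then have M: "M = center"
    by (simp only: center_def)
  have focus: "vector [s * c, 0] = F"
    by (simp add: F_def f_def)
  show ?thesis
    using is_caustic_locus is_incircle_poncelet_family stationary_orthocenter_focus
    unfolding E M r focus by blast
qed

end
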